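(* Let $\mathfrak{V}$ be a vessel with $\sigma_1$ invertible. Consider the system of discrete-time input compatibility equations for $a:\mathbb{N}^d\to\mathcal{E}$: $$\sigma_k a(n+e_j)-\sigma_j a(n+e_k)+i\gamma_{jk}a(n)=0,\qquad n\in\mathbb{N}^d,\ j,k=1,\ldots,d.$$ The following set of conditions (for all $j,k=2,\ldots,d$) is necessary and sufficient for this system to have a solution for every initial condition along the $n_1$-axis (that is, for every $b:\mathbb{N}\to\mathcal{E}$ there is a solution $a$ with $a(n_1,0,\ldots,0)=b(n_1)$ for all $n_1$): (1) $[\sigma_1^{-1}\sigma_j,\sigma_1^{-1}\sigma_k]=0$; (2) $[\sigma_1^{-1}\gamma_{1j},\sigma_1^{-1}\gamma_{1k}]=0$; (3) $[\sigma_1^{-1}\sigma_k,\sigma_1^{-1}\gamma_{1j}]=[\sigma_1^{-1}\sigma_j,\sigma_1^{-1}\gamma_{1k}]$; (4) $\gamma_{jk}=\sigma_j\sigma_1^{-1}\gamma_{1k}-\sigma_k\sigma_1^{-1}\gamma_{1j}$.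
   Context: Here $0\in\mathbb{N}$ and $e_j$ is the $j$-th standard basis vector. A (Livsic commutative operator) vessel is a collection $\mathfrak{V}=(\mathcal{H},\mathcal{E},\Phi,\{A_j\},\{\sigma_j\},\{\gamma_{jk}\},\{\gamma_{*jk}\})$, where $\mathcal{H},\mathcal{E}$ are separable Hilbert spaces, $A_1,\ldots,A_d$ are commuting bounded (not necessarily selfadjoint) operators on $\mathcal{H}$, $\Phi:\mathcal{H}\to\mathcal{E}$ is bounded, and $\sigma_j,\gamma_{jk},\gamma_{*jk}$ ($j,k=1,\ldots,d$) are bounded selfadjoint operators on $\mathcal{E}$ such that for all $j,k$: $A_k-A_k^*=i\Phi^*\sigma_k\Phi$; $\gamma_{jk}=-\gamma_{kj}$, $\gamma_{*jk}=-\gamma_{*kj}$; $\sigma_j\Phi A_k^*-\sigma_k\Phi A_j^*=\gamma_{jk}\Phi$; $\sigma_j\Phi A_k-\sigma_k\Phi A_j=\gamma_{*jk}\Phi$; $\gamma_{*jk}-\gamma_{jk}=i(\sigma_j\Phi\Phi^*\sigma_k-\sigma_k\Phi\Phi^*\sigma_j)$. *)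

theory Defs
  imports "HOL-Analysis.Analysis"
begin

section \<open>Complex Hilbert spaces and their bounded operators\<close>

text \<open>The inner product is linear in the first argument and conjugate-linear in the second.
  Completeness and the compatibility of the norm with the topology and with the real scalar
  multiplication come from \<^class>\<open>banach\<close>; positive definiteness is part of
  \<open>cinner_self\<close>.\<close>

class chilbert_space = banach +
  fixes scaleC :: "complex \<Rightarrow> 'a \<Rightarrow> 'a" (infixr "*\<^sub>C" 75)
    and cinner :: "'a \<Rightarrow> 'a \<Rightarrow> complex"
  assumes scaleC_add_right: "c *\<^sub>C (x + y) = c *\<^sub>C x + c *\<^sub>C y"
    and scaleC_add_left: "(c + c') *\<^sub>C x = c *\<^sub>C x + c' *\<^sub>C x"
    and scaleC_scaleC: "c *\<^sub>C (c' *\<^sub>C x) = (c * c') *\<^sub>C x"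
    and scaleC_of_real: "complex_of_real r *\<^sub>C x = r *\<^sub>R x"
    and cinner_commute: "cinner x y = cnj (cinner y x)"
    and cinner_add_left: "cinner (x + y) z = cinner x z + cinner y z"
    and cinner_scaleC_left: "cinner (c *\<^sub>C x) y = c * cinner x y"
    and cinner_self: "cinner x x = complex_of_real ((norm x)\<^sup>2)"

instantiation complex :: chilbert_space
begin

definition scaleC_complex :: "complex \<Rightarrow> complex \<Rightarrow> complex"
  where "scaleC_complex c x = c * x"

definition cinner_complex :: "complex \<Rightarrow> complex \<Rightarrow> complex"
  where "cinner_complex x y = x * cnj y"

instance
proof
  fix c c' x y z :: complex and r :: real
  show "c *\<^sub>C (x + y) = c *\<^sub>C x + c *\<^sub>C y"
    and "(c + c') *\<^sub>C x = c *\<^sub>C x + c' *\<^sub>C x"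
    and "c *\<^sub>C (c' *\<^sub>C x) = (c * c') *\<^sub>C x"
    and "complex_of_real r *\<^sub>C x = r *\<^sub>R x"
    by (simp_all add: scaleC_complex_def algebra_simps scaleR_conv_of_real)
  show "cinner x y = cnj (cinner y x)"
    by (simp add: cinner_complex_def)
  show "cinner (x + y) z = cinner x z + cinner y z"
    and "cinner (c *\<^sub>C x) y = c * cinner x y"
    by (simp_all add: cinner_complex_def scaleC_complex_def algebra_simps)
  show "cinner x x = complex_of_real ((norm x)\<^sup>2)"
    unfolding cinner_complex_def by (rule complex_norm_square[symmetric])
qed

end

definition bounded_clinear ::
    "('a::chilbert_space \<Rightarrow> 'b::chilbert_space) \<Rightarrow> bool"
  where "bounded_clinear f \<longleftrightarrow> bounded_linear f \<and> (\<forall>c x. f (c *\<^sub>C x) = c *\<^sub>C f x)"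

text \<open>For bounded \<open>f\<close> the operator chosen here exists by the Riesz representation theorem and
  is unique.\<close>

definition cadjoint ::
    "('a::chilbert_space \<Rightarrow> 'b::chilbert_space) \<Rightarrow> 'b \<Rightarrow> 'a"
  where "cadjoint f = (SOME g. \<forall>x y. cinner (f x) y = cinner x (g y))"

definition bounded_selfadjoint :: "('a::chilbert_space \<Rightarrow> 'a) \<Rightarrow> bool"
  where "bounded_selfadjoint f \<longleftrightarrow> bounded_clinear f \<and> cadjoint f = f"

text \<open>Invertibility in the algebra of bounded operators; the inverse is then \<^term>\<open>inv f\<close>.\<close>

definition invertible_op :: "('a::chilbert_space \<Rightarrow> 'a) \<Rightarrow> bool"
  where "invertible_op f \<longleftrightarrow> (\<exists>g. bounded_clinear g \<and> g \<circ> f = id \<and> f \<circ> g = id)"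

definition commutator ::
    "('a \<Rightarrow> 'a) \<Rightarrow> ('a \<Rightarrow> 'a) \<Rightarrow> 'a \<Rightarrow> 'a::ab_group_add"
  where "commutator f g = (\<lambda>x. f (g x) - g (f x))"

section \<open>Vessels\<close>

text \<open>The families are indexed by all natural numbers, but only the indices in
  \<open>{1..d}\<close> are meaningful; \<open>\<gamma>s\<close> stands for the operators $\gamma_*$.\<close>

locale vessel =
  fixes d :: nat
    and A :: "nat \<Rightarrow> 'h::chilbert_space \<Rightarrow> 'h"
    and \<Phi> :: "'h \<Rightarrow> 'e::chilbert_space"
    and \<sigma> :: "nat \<Rightarrow> 'e \<Rightarrow> 'e"
    and \<gamma> \<gamma>s :: "nat \<Rightarrow> nat \<Rightarrow> 'e \<Rightarrow> 'e"
  assumes d_pos: "1 \<le> d"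
    and separable_H: "\<exists>D :: 'h set. countable D \<and> closure D = UNIV"
    and separable_E: "\<exists>D :: 'e set. countable D \<and> closure D = UNIV"
    and bounded_A: "j \<in> {1..d} \<Longrightarrow> bounded_clinear (A j)"
    and commute_A: "\<lbrakk>j \<in> {1..d}; k \<in> {1..d}\<rbrakk> \<Longrightarrow> A j \<circ> A k = A k \<circ> A j"
    and bounded_Phi: "bounded_clinear \<Phi>"
    and selfadjoint_sigma: "j \<in> {1..d} \<Longrightarrow> bounded_selfadjoint (\<sigma> j)"
    and selfadjoint_gamma:
      "\<lbrakk>j \<in> {1..d}; k \<in> {1..d}\<rbrakk> \<Longrightarrow> bounded_selfadjoint (\<gamma> j k)"
    and selfadjoint_gammas:
      "\<lbrakk>j \<in> {1..d}; k \<in> {1..d}\<rbrakk> \<Longrightarrow> bounded_selfadjoint (\<gamma>s j k)"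
    and colligation:
      "k \<in> {1..d} \<Longrightarrow> A k h - cadjoint (A k) h = \<i> *\<^sub>C cadjoint \<Phi> (\<sigma> k (\<Phi> h))"
    and gamma_antisym:
      "\<lbrakk>j \<in> {1..d}; k \<in> {1..d}\<rbrakk> \<Longrightarrow> \<gamma> j k u = - \<gamma> k j u"
    and gammas_antisym:
      "\<lbrakk>j \<in> {1..d}; k \<in> {1..d}\<rbrakk> \<Longrightarrow> \<gamma>s j k u = - \<gamma>s k j u"
    and input_vessel:
      "\<lbrakk>j \<in> {1..d}; k \<in> {1..d}\<rbrakk> \<Longrightarrow>
        \<sigma> j (\<Phi> (cadjoint (A k) h)) - \<sigma> k (\<Phi> (cadjoint (A j) h)) = \<gamma> j k (\<Phi> h)"
    and output_vessel:
      "\<lbrakk>j \<in> {1..d}; k \<in> {1..d}\<rbrakk> \<Longrightarrow>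
        \<sigma> j (\<Phi> (A k h)) - \<sigma> k (\<Phi> (A j h)) = \<gamma>s j k (\<Phi> h)"
    and linkage:
      "\<lbrakk>j \<in> {1..d}; k \<in> {1..d}\<rbrakk> \<Longrightarrow>
        \<gamma>s j k u - \<gamma> j k u =
          \<i> *\<^sub>C (\<sigma> j (\<Phi> (cadjoint \<Phi> (\<sigma> k u))) - \<sigma> k (\<Phi> (cadjoint \<Phi> (\<sigma> j u))))"

section \<open>Discrete-time input compatibility equations\<close>

text \<open>A point $(n_1,\ldots,n_d)$ of $\mathbb{N}^d$ is encoded as a function supported in
  \<open>{1..d}\<close>. Sequences are total functions whose values off this set never matter.\<close>

definition multi_indices :: "nat \<Rightarrow> (nat \<Rightarrow> nat) set"
  where "multi_indices d = {n. \<forall>i. i \<notin> {1..d} \<longrightarrow> n i = 0}"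

definition basis_vec :: "nat \<Rightarrow> nat \<Rightarrow> nat"
  where "basis_vec j = (\<lambda>i. if i = j then 1 else 0)"

definition input_compatible ::
    "nat \<Rightarrow> (nat \<Rightarrow> 'e \<Rightarrow> 'e) \<Rightarrow> (nat \<Rightarrow> nat \<Rightarrow> 'e \<Rightarrow> 'e) \<Rightarrow>
      ((nat \<Rightarrow> nat) \<Rightarrow> 'e::chilbert_space) \<Rightarrow> bool"
  where "input_compatible d \<sigma> \<gamma> a \<longleftrightarrow>
    (\<forall>n\<in>multi_indices d. \<forall>j\<in>{1..d}. \<forall>k\<in>{1..d}.
      \<sigma> k (a (\<lambda>i. n i + basis_vec j i)) - \<sigma> j (a (\<lambda>i. n i + basis_vec k i))
        + \<i> *\<^sub>C \<gamma> j k (a n) = 0)"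

end

theory Submission
  imports Defs
begin

text \<open>Put \<open>S k = inv (\<sigma> 1) \<circ> \<sigma> k\<close> and \<open>G k = inv (\<sigma> 1) \<circ> \<gamma> 1 k\<close>. The equations with \<open>j = 1\<close> say that
  on sequences along the $n_1$-axis a step in direction $k$ is the operator
  \<open>P k = S k T + \<i> G k\<close>, where \<open>T = P 1\<close> is the shift. Solvability for all initial data forces the
  \<open>P k\<close> to commute, and comparing the coefficients of $T^2$, $T$ and $1$ gives (1), (3) and (2).
  The remaining equations become an identity in the independent values $b(0)$, $b(1)$,
  that is, (1) and (4). Conversely the solution is
  $a(n) = (P_1^{n_1} \cdots P_d^{n_d} b)(0)$.\<close>

section \<open>Calculation with bounded complex-linear maps and complex scalars\<close>

lemma bounded_clinear_add: "bounded_clinear f \<Longrightarrow> f (x + y) = f x + f y"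
  and bounded_clinear_diff: "bounded_clinear f \<Longrightarrow> f (x - y) = f x - f y"
  and bounded_clinear_zero: "bounded_clinear f \<Longrightarrow> f 0 = 0"
  and bounded_clinear_scaleC: "bounded_clinear f \<Longrightarrow> f (c *\<^sub>C x) = c *\<^sub>C f x"
  by (simp_all add: bounded_clinear_def bounded_linear.linear linear_add linear_diff linear_0)

lemmas bounded_clinear_simps =
  bounded_clinear_add bounded_clinear_diff bounded_clinear_zero bounded_clinear_scaleC

lemma bounded_clinear_comp:
  "bounded_clinear f \<Longrightarrow> bounded_clinear g \<Longrightarrow> bounded_clinear (f \<circ> g)"
  using bounded_linear_compose[of f g] by (simp add: bounded_clinear_def comp_def)

lemma scaleC_one: "1 *\<^sub>C x = (x :: 'a::chilbert_space)"
  using scaleC_of_real[of 1 x] by simp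

lemma scaleC_zero_right: "c *\<^sub>C 0 = (0 :: 'a::chilbert_space)"
  using scaleC_add_right[of c 0 0] by simp

lemma scaleC_minus_right: "c *\<^sub>C (- x) = - (c *\<^sub>C (x :: 'a::chilbert_space))"
  using scaleC_add_right[of c "- x" x]
  by (simp add: scaleC_zero_right eq_neg_iff_add_eq_0)

lemma scaleC_diff_right: "c *\<^sub>C (x - y) = c *\<^sub>C x - c *\<^sub>C (y :: 'a::chilbert_space)"
  using scaleC_add_right[of c x "- y"] by (simp add: scaleC_minus_right)

lemma scaleC_cancel: "c \<noteq> 0 \<Longrightarrow> c *\<^sub>C x = c *\<^sub>C y \<longleftrightarrow> x = (y :: 'a::chilbert_space)"
  by (metis scaleC_scaleC scaleC_one left_inverse)

lemma scaleC_i_i: "\<i> *\<^sub>C \<i> *\<^sub>C x = - (x :: 'a::chilbert_space)"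
  using scaleC_of_real[of "- 1" x] by (simp add: scaleC_scaleC)

section \<open>Step operators on sequences and when two of them commute\<close>

definition step_op ::
    "('a \<Rightarrow> 'a) \<Rightarrow> ('a \<Rightarrow> 'a) \<Rightarrow> (nat \<Rightarrow> 'a) \<Rightarrow> nat \<Rightarrow> 'a::chilbert_space"
  where "step_op S G f = (\<lambda>m. S (f (Suc m)) + \<i> *\<^sub>C G (f m))"

text \<open>Expansion of (S T + i G)(S' T + i G') in powers of the shift T, which commutes with
  operators acting pointwise.\<close>

lemma step_op_step_op:
  assumes "bounded_clinear S" "bounded_clinear G"
  shows "step_op S G (step_op S' G' f) m =
    S (S' (f (Suc (Suc m)))) + \<i> *\<^sub>C (S (G' (f (Suc m))) + G (S' (f (Suc m)))) - G (G' (f m))"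
  using assms by (simp add: step_op_def bounded_clinear_simps scaleC_add_right scaleC_i_i)

text \<open>At position 0 both products see only \<open>f 0\<close>, \<open>f 1\<close>,
  \<open>f 2\<close>, which are free. An impulse at 2, 0 or 1 isolates the coefficient of T^2, 1 or
  T.\<close>

lemma step_op_commute_at_0_imp:
  assumes lin: "bounded_clinear S" "bounded_clinear G" "bounded_clinear S'" "bounded_clinear G'"
    and comm: "\<And>f. step_op S G (step_op S' G' f) 0 = step_op S' G' (step_op S G f) 0"
  shows "commutator S S' = (\<lambda>u. 0)"
    and "commutator G G' = (\<lambda>u. 0)"
    and "commutator S' G = commutator S G'"
proof -
  note simps = step_op_step_op lin bounded_clinear_zero scaleC_zero_right
  have "S (S' u) = S' (S u)" for u
    using comm[of "\<lambda>i. if i = 2 then u else 0"] by (simp add: simps numeral_2_eq_2)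
  then show "commutator S S' = (\<lambda>u. 0)" by (simp add: commutator_def)
  have "G (G' u) = G' (G u)" for u
    using comm[of "\<lambda>i. if i = 0 then u else 0"] by (simp add: simps)
  then show "commutator G G' = (\<lambda>u. 0)" by (simp add: commutator_def)
  have "S (G' u) + G (S' u) = S' (G u) + G' (S u)" for u
    using comm[of "\<lambda>i. if i = 1 then u else 0"] by (simp add: simps scaleC_cancel)
  then show "commutator S' G = commutator S G'"
    by (simp add: commutator_def fun_eq_iff algebra_simps)
qed

text \<open>The two expansions agree coefficient by coefficient at every position, so commutation
  holds on whole sequences, as powers of the operators require.\<close>

lemma step_op_commute:
  assumes lin: "bounded_clinear S" "bounded_clinear G" "bounded_clinear S'" "bounded_clinear G'"
    and "commutator S S' = (\<lambda>u. 0)"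
    and "commutator G G' = (\<lambda>u. 0)"
    and "commutator S' G = commutator S G'"
  shows "step_op S G \<circ> step_op S' G' = step_op S' G' \<circ> step_op S G"
proof -
  have "S (S' u) = S' (S u)" "G (G' u) = G' (G u)"
    "S (G' u) + G (S' u) = S' (G u) + G' (S u)" for u
    using assms(5-7)[THEN fun_cong, of u] by (simp_all add: commutator_def algebra_simps)
  then show ?thesis
    by (simp add: fun_eq_iff step_op_step_op lin)
qed

section \<open>Multi-index powers of commuting operators\<close>

fun funpow_prod :: "(nat \<Rightarrow> 'a \<Rightarrow> 'a) \<Rightarrow> (nat \<Rightarrow> nat) \<Rightarrow> nat \<Rightarrow> 'a \<Rightarrow> 'a" where
  "funpow_prod P n 0 = id"
| "funpow_prod P n (Suc d) = (P (Suc d) ^^ n (Suc d)) \<circ> funpow_prod P n d"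

lemma funpow_prod_cong:
  "(\<And>i. i \<in> {1..d} \<Longrightarrow> n i = n' i) \<Longrightarrow> funpow_prod P n d = funpow_prod P n' d"
  by (induction d) auto

lemma funpow_comp_commute:
  assumes "p \<circ> q = q \<circ> p"
  shows "(p ^^ n) \<circ> q = q \<circ> (p ^^ n)"
proof (induction n)
  case (Suc n)
  then show ?case
    using assms by (metis funpow.simps(2) comp_assoc)
qed simp

text \<open>The additional factor \<open>P k\<close> arises next to its own power and is carried to
  the front past the powers of higher index.\<close>

lemma funpow_prod_add_basis_vec:
  assumes "\<And>i j. i \<in> {1..d} \<Longrightarrow> j \<in> {1..d} \<Longrightarrow> P i \<circ> P j = P j \<circ> P i"
    and "k \<in> {1..d}"
  shows "funpow_prod P (\<lambda>i. n i + basis_vec k i) d = P k \<circ> funpow_prod P n d"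
  using assms
proof (induction d)
  case (Suc d)
  show ?case
  proof (cases "k = Suc d")
    case True
    have "funpow_prod P (\<lambda>i. n i + basis_vec k i) d = funpow_prod P n d"
      by (rule funpow_prod_cong) (auto simp: basis_vec_def True)
    then show ?thesis
      by (simp add: True basis_vec_def comp_assoc)
  next
    case False
    then have k: "k \<in> {1..d}" using Suc.prems(2) by auto
    have IH: "funpow_prod P (\<lambda>i. n i + basis_vec k i) d = P k \<circ> funpow_prod P n d"
      using Suc.prems(1) k by (intro Suc.IH) auto
    have comm: "(P (Suc d) ^^ n (Suc d)) \<circ> P k = P k \<circ> (P (Suc d) ^^ n (Suc d))"
      by (intro funpow_comp_commute Suc.prems(1)) (use k in auto)
    have "n (Suc d) + basis_vec k (Suc d) = n (Suc d)"
      using False by (simp add: basis_vec_def)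
    then show ?thesis
      by (simp only: funpow_prod.simps IH comp_assoc[symmetric] comm)
  qed
qed simp

lemma funpow_prod_axis:
  "1 \<le> d \<Longrightarrow> funpow_prod P (\<lambda>i. if i = 1 then m else 0) d = P 1 ^^ m"
proof (induction d rule: dec_induct)
  case base
  show ?case by simp
next
  case (step d)
  then show ?case by simp
qed

lemma funpow_shift: "((\<lambda>f i. f (Suc i)) ^^ m) f i = f (m + i)"
  by (induction m arbitrary: i) simp_all

section \<open>The compatibility equations for abstract coefficients\<close>

locale compatibility_coefficients =
  fixes d :: nat and \<sigma> :: "nat \<Rightarrow> 'e \<Rightarrow> 'e::chilbert_space" and \<gamma> :: "nat \<Rightarrow> nat \<Rightarrow> 'e \<Rightarrow> 'e"
  assumes d_pos: "1 \<le> d"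
    and lin_sigma: "j \<in> {1..d} \<Longrightarrow> bounded_clinear (\<sigma> j)"
    and lin_gamma: "j \<in> {1..d} \<Longrightarrow> k \<in> {1..d} \<Longrightarrow> bounded_clinear (\<gamma> j k)"
    and gamma_antisym: "j \<in> {1..d} \<Longrightarrow> k \<in> {1..d} \<Longrightarrow> \<gamma> j k u = - \<gamma> k j u"
    and invertible: "invertible_op (\<sigma> 1)"
begin

text \<open>Keeps the index 1 from turning into \<open>Suc 0\<close>, so that facts about
  \<open>\<sigma> 1\<close>, \<open>S 1\<close> and \<open>G 1\<close> still match.\<close>

declare One_nat_def [simp del]

abbreviation S where "S k \<equiv> inv (\<sigma> 1) \<circ> \<sigma> k"
abbreviation G where "G k \<equiv> inv (\<sigma> 1) \<circ> \<gamma> 1 k"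
abbreviation P where "P k \<equiv> step_op (S k) (G k)"

text \<open>Conditions (1)-(4) for one pair, worded so that the final statement folds to it; the
  index 1 is allowed so that all directions can be treated alike.\<close>

definition solvability_conditions :: "nat \<Rightarrow> nat \<Rightarrow> bool" where
  "solvability_conditions j k \<longleftrightarrow>
      commutator (S j) (S k) = (\<lambda>u. 0)
    \<and> commutator (G j) (G k) = (\<lambda>u. 0)
    \<and> commutator (S k) (G j) = commutator (S j) (G k)
    \<and> \<gamma> j k = (\<lambda>u. \<sigma> j (inv (\<sigma> 1) (\<gamma> 1 k u)) - \<sigma> k (inv (\<sigma> 1) (\<gamma> 1 j u)))"

lemma inv_sigma: "inv (\<sigma> 1) (\<sigma> 1 u) = u" "\<sigma> 1 (inv (\<sigma> 1) u) = u"
  and lin_inv: "bounded_clinear (inv (\<sigma> 1))"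
proof -
  obtain g where g: "bounded_clinear g" "g \<circ> \<sigma> 1 = id" "\<sigma> 1 \<circ> g = id"
    using invertible by (auto simp: invertible_op_def)
  then have "inv (\<sigma> 1) = g" by (intro inv_unique_comp)
  with g show "inv (\<sigma> 1) (\<sigma> 1 u) = u" "\<sigma> 1 (inv (\<sigma> 1) u) = u" "bounded_clinear (inv (\<sigma> 1))"
    by (simp_all add: pointfree_idE)
qed

lemma lin_S: "k \<in> {1..d} \<Longrightarrow> bounded_clinear (S k)"
  and lin_G: "k \<in> {1..d} \<Longrightarrow> bounded_clinear (G k)"
  using d_pos by (simp_all add: bounded_clinear_comp lin_inv lin_sigma lin_gamma)

text \<open>Antisymmetry makes \<open>\<gamma> 1 1\<close> its own negative, hence zero. So
  \<open>P 1\<close> will be the pure shift.\<close>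

lemma S_1: "S 1 = id" and G_1: "G 1 = (\<lambda>u. 0)"
proof -
  show "S 1 = id" by (simp add: fun_eq_iff inv_sigma)
  have "\<gamma> 1 1 u + \<gamma> 1 1 u = 0" for u
    using gamma_antisym[of 1 1 u] d_pos by (simp flip: eq_neg_iff_add_eq_0)
  then have "\<gamma> 1 1 u = 0" for u
    by (metis scaleR_2 scaleR_eq_0_iff zero_neq_numeral)
  then show "G 1 = (\<lambda>u. 0)"
    using lin_inv by (simp add: fun_eq_iff bounded_clinear_zero)
qed

lemma P_1: "P 1 = (\<lambda>f i. f (Suc i))"
  unfolding step_op_def S_1 G_1 by (simp add: scaleC_zero_right)

text \<open>The identity and zero commute with every linear operator, which settles (1)-(3); (4)
  reduces to a trivial identity or to antisymmetry. This extends the index range from {2..d} to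
  {1..d}.\<close>

lemma solvability_conditions_1:
  assumes "k \<in> {1..d}"
  shows "solvability_conditions 1 k" and "solvability_conditions k 1"
proof -
  have one: "(1::nat) \<in> {1..d}" using d_pos by simp
  have G1: "inv (\<sigma> 1) (\<gamma> 1 1 u) = 0" for u
    using fun_cong[OF G_1, of u] by simp
  have zero: "\<sigma> k 0 = 0" "S k 0 = 0" "G k 0 = 0"
    using assms by (simp_all only: bounded_clinear_zero lin_sigma lin_S lin_G)
  have "\<gamma> k 1 u = - \<gamma> 1 k u" for u
    using gamma_antisym one assms by blast
  then show "solvability_conditions 1 k" "solvability_conditions k 1"
    unfolding solvability_conditions_def S_1 G_1 G1 inv_sigma commutator_def
    by (simp_all only: fun_eq_iff id_apply zero diff_self diff_0 diff_0_right simp_thms)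
qed

text \<open>The equation for the pair (1, k), solved for the step in direction k by applying the
  inverse of \<open>\<sigma> 1\<close>.\<close>

lemma solution_step:
  assumes "input_compatible d \<sigma> \<gamma> a" "n \<in> multi_indices d" "k \<in> {1..d}"
  shows "a (\<lambda>i. n i + basis_vec k i) = S k (a (\<lambda>i. n i + basis_vec 1 i)) + \<i> *\<^sub>C G k (a n)"
proof -
  have "\<sigma> k (a (\<lambda>i. n i + basis_vec 1 i)) - \<sigma> 1 (a (\<lambda>i. n i + basis_vec k i))
      + \<i> *\<^sub>C \<gamma> 1 k (a n) = 0"
    using assms d_pos unfolding input_compatible_def by (metis atLeastAtMost_iff le_refl)
  then have "\<sigma> 1 (a (\<lambda>i. n i + basis_vec k i)) =
      \<sigma> k (a (\<lambda>i. n i + basis_vec 1 i)) + \<i> *\<^sub>C \<gamma> 1 k (a n)"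
    by (simp add: algebra_simps)
  then have "inv (\<sigma> 1) (\<sigma> 1 (a (\<lambda>i. n i + basis_vec k i))) =
      inv (\<sigma> 1) (\<sigma> k (a (\<lambda>i. n i + basis_vec 1 i)) + \<i> *\<^sub>C \<gamma> 1 k (a n))"
    by (rule arg_cong)
  then show ?thesis
    unfolding inv_sigma by (simp only: bounded_clinear_add bounded_clinear_scaleC lin_inv o_apply)
qed

text \<open>Reaching e_j + e_k from the origin in either order gives the same value of a, so
  \<open>P j\<close> and \<open>P k\<close> commute at 0 for every b; this yields (1)-(3). The
  equation at the origin yields (4).\<close>

lemma solvable_imp_conditions:
  assumes solv: "\<And>b. \<exists>a. input_compatible d \<sigma> \<gamma> a \<and> (\<forall>m. a (\<lambda>i. if i = 1 then m else 0) = b m)"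
    and jk: "j \<in> {1..d}" "k \<in> {1..d}"
  shows "solvability_conditions j k"
proof -
  have ax: "(\<lambda>i. if i = 1 then m else 0) \<in> multi_indices d" for m
    using d_pos by (auto simp: multi_indices_def)
  have ax_Suc: "(\<lambda>i. (if i = 1 then m else 0) + basis_vec 1 i) = (\<lambda>i. if i = 1 then Suc m else 0)" for m
    by (auto simp: basis_vec_def)
  have near_axis: "a (\<lambda>i. (if i = 1 then m else 0) + basis_vec l i) = P l b m"
    if "input_compatible d \<sigma> \<gamma> a" "\<forall>m. a (\<lambda>i. if i = 1 then m else 0) = b m" "l \<in> {1..d}"
    for a b l m
    using solution_step[OF that(1) ax that(3), of m] that(2) by (simp only: ax_Suc step_op_def)
  \<comment> \<open>The recursion at e_l needs a at e_l + e_1 and at e_l. Both lie one step in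
    direction l off the axis, over the positions 1 and 0.\<close>
  have two_steps: "a (\<lambda>i. basis_vec l i + basis_vec l' i) = P l' (P l b) 0"
    if sol: "input_compatible d \<sigma> \<gamma> a" "\<forall>m. a (\<lambda>i. if i = 1 then m else 0) = b m"
      and l: "l \<in> {1..d}" "l' \<in> {1..d}"
    for a b l l'
  proof -
    have "basis_vec l \<in> multi_indices d"
      using l by (auto simp: basis_vec_def multi_indices_def)
    from solution_step[OF sol(1) this l(2)]
    have "a (\<lambda>i. basis_vec l i + basis_vec l' i) =
      S l' (a (\<lambda>i. basis_vec l i + basis_vec 1 i)) + \<i> *\<^sub>C G l' (a (basis_vec l))" .
    moreover have "(\<lambda>i. basis_vec l i + basis_vec 1 i) = (\<lambda>i. (if i = 1 then Suc 0 else 0) + basis_vec l i)"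
      "basis_vec l = (\<lambda>i. (if i = 1 then 0 else 0) + basis_vec l i)"
      by (auto simp: basis_vec_def)
    ultimately show ?thesis
      using near_axis[OF sol l(1), of 0] near_axis[OF sol l(1), of "Suc 0"]
      by (simp only: step_op_def)
  qed
  have comm: "P j (P k b) 0 = P k (P j b) 0" for b
  proof -
    obtain a where a: "input_compatible d \<sigma> \<gamma> a" "\<forall>m. a (\<lambda>i. if i = 1 then m else 0) = b m"
      using solv by blast
    have "(\<lambda>i. basis_vec k i + basis_vec j i) = (\<lambda>i. basis_vec j i + basis_vec k i)"
      by (simp add: add.commute)
    then show ?thesis
      using two_steps[OF a jk] two_steps[OF a jk(2,1)] by metis
  qed
  have "\<gamma> j k u = \<sigma> j (inv (\<sigma> 1) (\<gamma> 1 k u)) - \<sigma> k (inv (\<sigma> 1) (\<gamma> 1 j u))" for u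
  proof -
    \<comment> \<open>With \<open>b 1 = 0\<close> the \<open>\<sigma>\<close> part of each step from
      the origin vanishes; the equation there becomes i times (4) applied to u.\<close>
    define b where "b = (\<lambda>m::nat. if m = 0 then u else 0)"
    obtain a where a: "input_compatible d \<sigma> \<gamma> a" "\<forall>m. a (\<lambda>i. if i = 1 then m else 0) = b m"
      using solv by blast
    have Pl: "P l b 0 = \<i> *\<^sub>C inv (\<sigma> 1) (\<gamma> 1 l u)" if "l \<in> {1..d}" for l
      using bounded_clinear_zero[OF lin_S[OF that]] by (simp add: step_op_def b_def)
    have "\<sigma> k (a (\<lambda>i. (if i = 1 then 0 else 0) + basis_vec j i))
        - \<sigma> j (a (\<lambda>i. (if i = 1 then 0 else 0) + basis_vec k i))
        + \<i> *\<^sub>C \<gamma> j k (a (\<lambda>i. if i = 1 then 0 else 0)) = 0"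
      using a(1) ax jk unfolding input_compatible_def by fast
    then have "\<i> *\<^sub>C (\<sigma> k (inv (\<sigma> 1) (\<gamma> 1 j u)) - \<sigma> j (inv (\<sigma> 1) (\<gamma> 1 k u)) + \<gamma> j k u) = \<i> *\<^sub>C 0"
      unfolding near_axis[OF a jk(1)] near_axis[OF a jk(2)] a(2)[rule_format] Pl[OF jk(1)] Pl[OF jk(2)]
      by (simp only: bounded_clinear_scaleC lin_sigma jk scaleC_add_right scaleC_diff_right
          scaleC_zero_right) (simp add: b_def)
    then show ?thesis
      by (simp add: scaleC_cancel algebra_simps eq_neg_iff_add_eq_0)
  qed
  then show ?thesis
    unfolding solvability_conditions_def
    using step_op_commute_at_0_imp[OF lin_S lin_G lin_S lin_G comm] jk by blast
qed

lemma conditions_imp_solvable: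
  assumes cond: "\<And>j k. j \<in> {1..d} \<Longrightarrow> k \<in> {1..d} \<Longrightarrow> solvability_conditions j k"
  shows "\<exists>a. input_compatible d \<sigma> \<gamma> a \<and> (\<forall>m. a (\<lambda>i. if i = 1 then m else 0) = b m)"
proof (intro exI conjI allI)
  define a where "a n = funpow_prod P n d b 0" for n
  have "P j \<circ> P k = P k \<circ> P j" if "j \<in> {1..d}" "k \<in> {1..d}" for j k
    using cond[OF that] that lin_S lin_G
    by (intro step_op_commute) (auto simp: solvability_conditions_def)
  then have a_step: "a (\<lambda>i. n i + basis_vec k i) = P k (funpow_prod P n d b) 0"
    if "k \<in> {1..d}" for n k
    using funpow_prod_add_basis_vec[of d P k n] that by (simp add: a_def)
  show "input_compatible d \<sigma> \<gamma> a"
    unfolding input_compatible_def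
  proof (intro ballI)
    fix n j k assume jk: "j \<in> {1..d}" "k \<in> {1..d}"
    \<comment> \<open>The equation at n involves only these two values of the evolved sequence: the
      v terms cancel by (1), the u terms by (4).\<close>
    define u v where "u = funpow_prod P n d b 0" and "v = funpow_prod P n d b (Suc 0)"
    note c = cond[OF jk, unfolded solvability_conditions_def commutator_def fun_eq_iff o_apply]
    have "inv (\<sigma> 1) (\<sigma> j (inv (\<sigma> 1) (\<sigma> k v))) = inv (\<sigma> 1) (\<sigma> k (inv (\<sigma> 1) (\<sigma> j v)))"
      using c by simp
    \<comment> \<open>Applying \<open>\<sigma> 1\<close> strips the outer inverse from (1).\<close>
    then have v: "\<sigma> j (inv (\<sigma> 1) (\<sigma> k v)) = \<sigma> k (inv (\<sigma> 1) (\<sigma> j v))"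
      by (metis inv_sigma(2))
    have g: "\<gamma> j k u = \<sigma> j (inv (\<sigma> 1) (\<gamma> 1 k u)) - \<sigma> k (inv (\<sigma> 1) (\<gamma> 1 j u))"
      using c by blast
    have "a (\<lambda>i. n i + basis_vec l i) = inv (\<sigma> 1) (\<sigma> l v) + \<i> *\<^sub>C inv (\<sigma> 1) (\<gamma> 1 l u)"
      if "l \<in> {1..d}" for l
      using a_step[OF that] by (simp add: step_op_def u_def v_def)
    moreover have "a n = u" by (simp add: a_def u_def)
    ultimately show "\<sigma> k (a (\<lambda>i. n i + basis_vec j i)) - \<sigma> j (a (\<lambda>i. n i + basis_vec k i))
        + \<i> *\<^sub>C \<gamma> j k (a n) = 0"
      using jk by (simp only: bounded_clinear_add bounded_clinear_scaleC lin_sigma v g scaleC_diff_right) simp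
  qed
  \<comment> \<open>On the axis only the m-th power of the shift remains, and it brings
    \<open>b m\<close> to position 0.\<close>
  show "a (\<lambda>i. if i = 1 then m else 0) = b m" for m
    unfolding a_def funpow_prod_axis[OF d_pos] P_1 funpow_shift by simp
qed

end

theorem proposition3p2:
  fixes d :: nat
    and A :: "nat \<Rightarrow> 'h::chilbert_space \<Rightarrow> 'h"
    and \<Phi> :: "'h \<Rightarrow> 'e::chilbert_space"
    and \<sigma> :: "nat \<Rightarrow> 'e \<Rightarrow> 'e"
    and \<gamma> \<gamma>s :: "nat \<Rightarrow> nat \<Rightarrow> 'e \<Rightarrow> 'e"
  assumes "vessel d A \<Phi> \<sigma> \<gamma> \<gamma>s"
    and "invertible_op (\<sigma> 1)"
  shows "(\<forall>b :: nat \<Rightarrow> 'e. \<exists>a :: (nat \<Rightarrow> nat) \<Rightarrow> 'e.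
            input_compatible d \<sigma> \<gamma> a \<and> (\<forall>m. a (\<lambda>i. if i = 1 then m else 0) = b m))
    \<longleftrightarrow>
    (\<forall>j\<in>{2..d}. \<forall>k\<in>{2..d}.
        commutator (inv (\<sigma> 1) \<circ> \<sigma> j) (inv (\<sigma> 1) \<circ> \<sigma> k) = (\<lambda>u. 0)
      \<and> commutator (inv (\<sigma> 1) \<circ> \<gamma> 1 j) (inv (\<sigma> 1) \<circ> \<gamma> 1 k) = (\<lambda>u. 0)
      \<and> commutator (inv (\<sigma> 1) \<circ> \<sigma> k) (inv (\<sigma> 1) \<circ> \<gamma> 1 j)
          = commutator (inv (\<sigma> 1) \<circ> \<sigma> j) (inv (\<sigma> 1) \<circ> \<gamma> 1 k)
      \<and> \<gamma> j k = (\<lambda>u. \<sigma> j (inv (\<sigma> 1) (\<gamma> 1 k u)) - \<sigma> k (inv (\<sigma> 1) (\<gamma> 1 j u))))"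
proof -
  interpret V: vessel d A \<Phi> \<sigma> \<gamma> \<gamma>s by fact
  interpret compatibility_coefficients d \<sigma> \<gamma>
    using V.d_pos V.selfadjoint_sigma V.selfadjoint_gamma assms(2)
    by unfold_locales (auto simp: bounded_selfadjoint_def intro: V.gamma_antisym)
  \<comment> \<open>Pairs containing the index 1 satisfy the conditions automatically.\<close>
  have "(\<forall>j\<in>{2..d}. \<forall>k\<in>{2..d}. solvability_conditions j k) \<longleftrightarrow>
      (\<forall>j\<in>{1..d}. \<forall>k\<in>{1..d}. solvability_conditions j k)"
  proof (intro iffI ballI)
    fix j k assume "\<forall>j\<in>{2..d}. \<forall>k\<in>{2..d}. solvability_conditions j k" "j \<in> {1..d}" "k \<in> {1..d}"
    then show "solvability_conditions j k"
      using solvability_conditions_1 by (cases "j = 1"; cases "k = 1") auto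
  qed auto
  then show ?thesis
    unfolding solvability_conditions_def[symmetric]
    using solvable_imp_conditions conditions_imp_solvable by blast
qed

end
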